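(* Let $\mathbf{A}\in\mathbb{C}^{n\times n\times n}$ be a hypermatrix generated by some arbitrary combination of direct sums and Kronecker products of $2\times2\times2$ complex hypermatrices, and assume that each $2\times2\times2$ generator hypermatrix admits a spectral decomposition. Then $\mathbf{A}$ admits a spectral decomposition, i.e. there exist $\mathbf{U},\mathbf{V},\mathbf{W},\mathbf{D}_0,\mathbf{D}_1,\mathbf{D}_2\in\mathbb{C}^{n\times n\times n}$ such that $$\mathbf{A}=\mathrm{Prod}\Big(\mathrm{Prod}(\mathbf{U},\mathbf{D}_0,\mathbf{D}_0^\top),\ \mathrm{Prod}(\mathbf{V},\mathbf{D}_1,\mathbf{D}_1^\top)^{\top^2},\ \mathrm{Prod}(\mathbf{W},\mathbf{D}_2,\mathbf{D}_2^\top)^{\top}\Big)$$ subject to $\mathrm{Prod}(\mathbf{U},\mathbf{V}^{\top^2},\mathbf{W}^\top)=\boldsymbol{\Delta}$ and $$[\mathbf{D}_0]_{ijk}=\begin{cases}\mu_{ij}=\mu_{ji}&j=k\\0&\text{otherwise}\end{cases},\quad[\mathbf{D}_1]_{ijk}=\begin{cases}\nu_{ij}=\nu_{ji}&j=k\\0&\text{otherwise}\end{cases},\quad[\mathbf{D}_2]_{ijk}=\begin{cases}\omega_{ij}=\omega_{ji}&j=k\\0&\text{otherwise}\end{cases}$$ for some symmetric complex arrays $(\mu_{ij}),(\nu_{ij}),(\omega_{ij})$, $0\le i,j<n$.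
   Context: All indices start at $0$. For $n\times n\times n$ complex hypermatrices, the Bhattacharya-Mesner product is $[\mathrm{Prod}(\mathbf{X},\mathbf{Y},\mathbf{Z})]_{i,j,k}=\sum_{0\le t<n}x_{itk}\,y_{ijt}\,z_{tjk}$; the transpose is $[\mathbf{X}^\top]_{i,j,k}=x_{kij}$, and $\mathbf{X}^{\top^2}=(\mathbf{X}^\top)^\top$; $\boldsymbol{\Delta}$ is the Kronecker delta (entry $1$ if $i=j=k$, else $0$). A spectral decomposition of an $n\times n\times n$ hypermatrix is a factorization exactly of the form, and subject to exactly the constraints, displayed in the claim; a $2\times2\times2$ generator "admits a spectral decomposition" if it has such a factorization with $n=2$. Entrywise the factorization reads $$a_{ijk}=\sum_{0\le t<n}(\mu_{it}u_{itk}\mu_{kt})(\nu_{jt}v_{jti}\nu_{it})(\omega_{kt}w_{ktj}\omega_{jt}),\qquad \sum_{0\le t<n}u_{itk}v_{jti}w_{ktj}=[\boldsymbol\Delta]_{ijk}.$$ For cubic third order hypermatrices $\mathbf{B}$ (side $n_0$) and $\mathbf{C}$ (side $n_1$), the direct sum $\mathbf{B}\oplus\mathbf{C}$ (side $n_0+n_1$) is the block diagonal hypermatrix with $[\mathbf{B}\oplus\mathbf{C}]_{ijk}=b_{ijk}$ if $i,j,k<n_0$, $=c_{i-n_0,j-n_0,k-n_0}$ if $i,j,k\ge n_0$, and $0$ otherwise; the Kronecker product (side $n_0n_1$) is $[\mathbf{B}\otimes\mathbf{C}]_{n_1i+i',\,n_1j+j',\,n_1k+k'}=b_{ijk}c_{i'j'k'}$.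 A hypermatrix is generated by combinations of direct sums and Kronecker products of $2\times2\times2$ hypermatrices (the generators) if it is obtained from finitely many of them by finitely many applications of $\oplus$ and $\otimes$ in any order. *)

theory Defs
  imports Complex_Main
begin

text \<open>
  Cubic hypermatrices of side \<open>n\<close> are functions of three indices that vanish unless all
  indices are below \<open>n\<close>, so that equality of hypermatrices is equality of functions.
\<close>

type_synonym hypermat = "nat \<Rightarrow> nat \<Rightarrow> nat \<Rightarrow> complex"

definition hypermats :: "nat \<Rightarrow> hypermat set" where
  "hypermats n = {X. \<forall>i j k. \<not> (i < n \<and> j < n \<and> k < n) \<longrightarrow> X i j k = 0}"

definition mk_hypermat :: "nat \<Rightarrow> hypermat \<Rightarrow> hypermat" where
  "mk_hypermat n f = (\<lambda>i j k. if i < n \<and> j < n \<and> k < n then f i j k else 0)"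

text \<open>The Bhattacharya-Mesner product.\<close>

definition bm_prod :: "nat \<Rightarrow> hypermat \<Rightarrow> hypermat \<Rightarrow> hypermat \<Rightarrow> hypermat" where
  "bm_prod n X Y Z = mk_hypermat n (\<lambda>i j k. \<Sum>t<n. X i t k * Y i j t * Z t j k)"

definition htranspose :: "hypermat \<Rightarrow> hypermat" where
  "htranspose X = (\<lambda>i j k. X k i j)"

definition hdelta :: "nat \<Rightarrow> hypermat" where
  "hdelta n = mk_hypermat n (\<lambda>i j k. if i = j \<and> j = k then 1 else 0)"

definition direct_sum :: "nat \<Rightarrow> nat \<Rightarrow> hypermat \<Rightarrow> hypermat \<Rightarrow> hypermat" where
  "direct_sum n0 n1 B C = mk_hypermat (n0 + n1) (\<lambda>i j k.
     if i < n0 \<and> j < n0 \<and> k < n0 then B i j k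
     else if i \<ge> n0 \<and> j \<ge> n0 \<and> k \<ge> n0 then C (i - n0) (j - n0) (k - n0)
     else 0)"

text \<open>
  For \<open>i' < n1\<close>, the index \<open>n1 * i + i'\<close> has quotient \<open>i\<close> and remainder \<open>i'\<close> modulo \<open>n1\<close>.
\<close>

definition kronecker :: "nat \<Rightarrow> nat \<Rightarrow> hypermat \<Rightarrow> hypermat \<Rightarrow> hypermat" where
  "kronecker n0 n1 B C = mk_hypermat (n0 * n1) (\<lambda>i j k.
     B (i div n1) (j div n1) (k div n1) * C (i mod n1) (j mod n1) (k mod n1))"

text \<open>\<open>generated G n A\<close>: \<open>A\<close> has side \<open>n\<close> and arises from generators in \<open>G\<close>, all of side 2.\<close>

inductive generated :: "hypermat set \<Rightarrow> nat \<Rightarrow> hypermat \<Rightarrow> bool" for G where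
  generator: "B \<in> G \<Longrightarrow> generated G 2 B"
| sum: "generated G n0 B \<Longrightarrow> generated G n1 C \<Longrightarrow>
    generated G (n0 + n1) (direct_sum n0 n1 B C)"
| kron: "generated G n0 B \<Longrightarrow> generated G n1 C \<Longrightarrow>
    generated G (n0 * n1) (kronecker n0 n1 B C)"

definition symmetric_array :: "nat \<Rightarrow> (nat \<Rightarrow> nat \<Rightarrow> complex) \<Rightarrow> bool" where
  "symmetric_array n m \<longleftrightarrow> (\<forall>i<n. \<forall>j<n. m i j = m j i)"

definition scaling_hypermat :: "nat \<Rightarrow> (nat \<Rightarrow> nat \<Rightarrow> complex) \<Rightarrow> hypermat" where
  "scaling_hypermat n m = mk_hypermat n (\<lambda>i j k. if j = k then m i j else 0)"

definition admits_spectral_decomposition :: "nat \<Rightarrow> hypermat \<Rightarrow> bool" where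
  "admits_spectral_decomposition n A \<longleftrightarrow>
    (\<exists>U \<in> hypermats n. \<exists>V \<in> hypermats n. \<exists>W \<in> hypermats n.
     \<exists>D0 \<in> hypermats n. \<exists>D1 \<in> hypermats n. \<exists>D2 \<in> hypermats n.
       A = bm_prod n
             (bm_prod n U D0 (htranspose D0))
             (htranspose (htranspose (bm_prod n V D1 (htranspose D1))))
             (htranspose (bm_prod n W D2 (htranspose D2))) \<and>
       bm_prod n U (htranspose (htranspose V)) (htranspose W) = hdelta n \<and>
       (\<exists>\<mu> \<nu> \<omega>. symmetric_array n \<mu> \<and> symmetric_array n \<nu> \<and> symmetric_array n \<omega> \<and>
          D0 = scaling_hypermat n \<mu> \<and> D1 = scaling_hypermat n \<nu> \<and> D2 = scaling_hypermat n \<omega>))"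

end

theory Submission imports Defs begin

text \<open>
  A spectral decomposition says that two trilinear contractions have prescribed values: the
  contraction \<open>\<Sum>t. u\<^sub>i\<^sub>t\<^sub>k v\<^sub>j\<^sub>t\<^sub>i w\<^sub>k\<^sub>t\<^sub>j\<close> of the factors themselves is the Kronecker delta, and that
  of the factors rescaled by symmetric arrays is the given hypermatrix.  Both the contraction and
  the rescaling \<open>u\<^sub>i\<^sub>t\<^sub>k \<mapsto> \<mu>\<^sub>i\<^sub>t u\<^sub>i\<^sub>t\<^sub>k \<mu>\<^sub>k\<^sub>t\<close> commute with direct sums and with Kronecker products:
  in a direct sum the summation index \<open>t\<close> is forced into the block that contains \<open>i\<close>, \<open>j\<close>, \<open>k\<close>, and
  in a Kronecker product the sum over \<open>t\<close> is a double sum over the quotient and the remainder of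
  \<open>t\<close>, which factors.  Direct sums and Kronecker products of deltas are deltas, and those of
  symmetric arrays are symmetric.  So a decomposition of \<open>B\<close> and one of \<open>C\<close> combine, factor by
  factor, to decompositions of their direct sum and of their Kronecker product, and the theorem
  follows by induction on the way in which the hypermatrix is generated.
\<close>

definition contraction :: "nat \<Rightarrow> hypermat \<Rightarrow> hypermat \<Rightarrow> hypermat \<Rightarrow> hypermat" where
  "contraction n U V W = mk_hypermat n (\<lambda>i j k. \<Sum>t<n. U i t k * V j t i * W k t j)"

definition rescale :: "nat \<Rightarrow> (nat \<Rightarrow> nat \<Rightarrow> complex) \<Rightarrow> hypermat \<Rightarrow> hypermat" where
  "rescale n m U = mk_hypermat n (\<lambda>i j k. m i j * U i j k * m k j)"

definition array_direct_sum ::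
  "nat \<Rightarrow> (nat \<Rightarrow> nat \<Rightarrow> complex) \<Rightarrow> (nat \<Rightarrow> nat \<Rightarrow> complex) \<Rightarrow> nat \<Rightarrow> nat \<Rightarrow> complex" where
  "array_direct_sum n0 m m' = (\<lambda>i j.
     if i < n0 \<and> j < n0 then m i j
     else if i \<ge> n0 \<and> j \<ge> n0 then m' (i - n0) (j - n0)
     else 0)"

definition array_kronecker ::
  "nat \<Rightarrow> (nat \<Rightarrow> nat \<Rightarrow> complex) \<Rightarrow> (nat \<Rightarrow> nat \<Rightarrow> complex) \<Rightarrow> nat \<Rightarrow> nat \<Rightarrow> complex" where
  "array_kronecker n1 m m' = (\<lambda>i j. m (i div n1) (j div n1) * m' (i mod n1) (j mod n1))"

lemma mk_hypermat_in_hypermats [simp]: "mk_hypermat n f \<in> hypermats n"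
  by (simp add: mk_hypermat_def hypermats_def)

lemma direct_sum_in_hypermats [simp]: "direct_sum n0 n1 B C \<in> hypermats (n0 + n1)"
  by (simp add: direct_sum_def)

lemma kronecker_in_hypermats [simp]: "kronecker n0 n1 B C \<in> hypermats (n0 * n1)"
  by (simp add: kronecker_def)

lemma mk_hypermat_cong:
  assumes "\<And>i j k. i < n \<Longrightarrow> j < n \<Longrightarrow> k < n \<Longrightarrow> f i j k = g i j k"
  shows "mk_hypermat n f = mk_hypermat n g"
  using assms by (auto simp: mk_hypermat_def fun_eq_iff)


section \<open>Spectral decompositions as contractions\<close>

lemma bm_prod_transposes_eq_contraction:
  "bm_prod n U (htranspose (htranspose V)) (htranspose W) = contraction n U V W"
  by (simp add: bm_prod_def contraction_def htranspose_def)

text \<open>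
  The delta conditions in the scaling hypermatrix and in its transpose leave only the term with
  \<open>t = j\<close>.
\<close>

lemma bm_prod_scaling_hypermat_eq_rescale:
  "bm_prod n U (scaling_hypermat n m) (htranspose (scaling_hypermat n m)) = rescale n m U"
  unfolding bm_prod_def rescale_def
proof (rule mk_hypermat_cong)
  fix i j k assume less: "i < n" "j < n" "k < n"
  have "(\<Sum>t<n. U i t k * scaling_hypermat n m i j t * htranspose (scaling_hypermat n m) t j k)
      = (\<Sum>t<n. if t = j then m i j * U i j k * m k j else 0)"
    using less by (intro sum.cong) (auto simp: scaling_hypermat_def mk_hypermat_def htranspose_def)
  then show "(\<Sum>t<n. U i t k * scaling_hypermat n m i j t * htranspose (scaling_hypermat n m) t j k)
      = m i j * U i j k * m k j"
    using less by simp
qed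

lemma admits_spectral_decomposition_iff:
  "admits_spectral_decomposition n A \<longleftrightarrow>
    (\<exists>U \<in> hypermats n. \<exists>V \<in> hypermats n. \<exists>W \<in> hypermats n. \<exists>\<mu> \<nu> \<omega>.
       symmetric_array n \<mu> \<and> symmetric_array n \<nu> \<and> symmetric_array n \<omega> \<and>
       A = contraction n (rescale n \<mu> U) (rescale n \<nu> V) (rescale n \<omega> W) \<and>
       contraction n U V W = hdelta n)" (is "_ \<longleftrightarrow> ?R")
proof
  assume "admits_spectral_decomposition n A"
  then obtain U V W \<mu> \<nu> \<omega> where
    mem: "U \<in> hypermats n" "V \<in> hypermats n" "W \<in> hypermats n" and
    sym: "symmetric_array n \<mu>" "symmetric_array n \<nu>" "symmetric_array n \<omega>" and
    A: "A = contraction n (rescale n \<mu> U) (rescale n \<nu> V) (rescale n \<omega> W)" and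
    delta: "contraction n U V W = hdelta n"
    unfolding admits_spectral_decomposition_def bm_prod_transposes_eq_contraction
    by (elim bexE exE conjE) (simp only: bm_prod_scaling_hypermat_eq_rescale)
  show ?R
    using mem sym A delta by blast
next
  have scaling: "scaling_hypermat n m \<in> hypermats n" for m
    by (simp add: scaling_hypermat_def)
  assume ?R
  then obtain U V W \<mu> \<nu> \<omega> where
    mem: "U \<in> hypermats n" "V \<in> hypermats n" "W \<in> hypermats n" and
    sym: "symmetric_array n \<mu>" "symmetric_array n \<nu>" "symmetric_array n \<omega>" and
    A: "A = contraction n (rescale n \<mu> U) (rescale n \<nu> V) (rescale n \<omega> W)" and
    delta: "contraction n U V W = hdelta n"
    by blast
  show "admits_spectral_decomposition n A"
    unfolding admits_spectral_decomposition_def bm_prod_transposes_eq_contraction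
  proof (intro bexI conjI)
    show "A = contraction n
        (bm_prod n U (scaling_hypermat n \<mu>) (htranspose (scaling_hypermat n \<mu>)))
        (bm_prod n V (scaling_hypermat n \<nu>) (htranspose (scaling_hypermat n \<nu>)))
        (bm_prod n W (scaling_hypermat n \<omega>) (htranspose (scaling_hypermat n \<omega>)))"
      by (simp only: A bm_prod_scaling_hypermat_eq_rescale)
    show "\<exists>\<mu>' \<nu>' \<omega>'. symmetric_array n \<mu>' \<and> symmetric_array n \<nu>' \<and> symmetric_array n \<omega>' \<and>
        scaling_hypermat n \<mu> = scaling_hypermat n \<mu>' \<and>
        scaling_hypermat n \<nu> = scaling_hypermat n \<nu>' \<and>
        scaling_hypermat n \<omega> = scaling_hypermat n \<omega>'"
      using sym by blast
  qed (fact delta mem scaling)+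
qed


section \<open>Direct sums\<close>

lemma sum_lessThan_add:
  fixes f :: "nat \<Rightarrow> 'a::comm_monoid_add"
  shows "(\<Sum>t<a + b. f t) = (\<Sum>t<a. f t) + (\<Sum>t<b. f (a + t))"
  by (induction b) (simp_all add: add.assoc)

lemma symmetric_array_direct_sum:
  assumes "symmetric_array n0 m" "symmetric_array n1 m'"
  shows "symmetric_array (n0 + n1) (array_direct_sum n0 m m')"
  using assms by (auto simp: symmetric_array_def array_direct_sum_def)

lemma hdelta_direct_sum: "direct_sum n0 n1 (hdelta n0) (hdelta n1) = hdelta (n0 + n1)"
  unfolding direct_sum_def hdelta_def
proof (rule mk_hypermat_cong)
  fix i j k assume "i < n0 + n1" "j < n0 + n1" "k < n0 + n1"
  then show "(if i < n0 \<and> j < n0 \<and> k < n0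
        then mk_hypermat n0 (\<lambda>i j k. if i = j \<and> j = k then 1 else 0) i j k
      else if i \<ge> n0 \<and> j \<ge> n0 \<and> k \<ge> n0
        then mk_hypermat n1 (\<lambda>i j k. if i = j \<and> j = k then 1 else 0) (i - n0) (j - n0) (k - n0)
      else 0) = (if i = j \<and> j = k then 1 else 0)"
    by (cases "i < n0"; cases "j < n0"; cases "k < n0")
      (simp_all add: mk_hypermat_def less_diff_conv2 eq_diff_iff add.commute)
qed

lemma rescale_direct_sum:
  "rescale (n0 + n1) (array_direct_sum n0 m m') (direct_sum n0 n1 B C) =
   direct_sum n0 n1 (rescale n0 m B) (rescale n1 m' C)"
  unfolding direct_sum_def rescale_def
  by (rule mk_hypermat_cong) (auto simp: mk_hypermat_def array_direct_sum_def)

text \<open>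
  A term \<open>u\<^sub>i\<^sub>t\<^sub>k v\<^sub>j\<^sub>t\<^sub>i w\<^sub>k\<^sub>t\<^sub>j\<close> of the contraction vanishes unless \<open>t\<close> lies in the same block as
  \<open>i\<close>, \<open>j\<close> and \<open>k\<close>.
\<close>

lemma contraction_direct_sum:
  "contraction (n0 + n1) (direct_sum n0 n1 U U') (direct_sum n0 n1 V V') (direct_sum n0 n1 W W') =
   direct_sum n0 n1 (contraction n0 U V W) (contraction n1 U' V' W')"
  unfolding contraction_def direct_sum_def
  by (rule mk_hypermat_cong) (auto simp: mk_hypermat_def sum_lessThan_add)

lemma admits_spectral_decomposition_direct_sum:
  assumes "admits_spectral_decomposition n0 B" "admits_spectral_decomposition n1 C"
  shows "admits_spectral_decomposition (n0 + n1) (direct_sum n0 n1 B C)"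
proof -
  obtain U V W \<mu> \<nu> \<omega> where
    sym: "symmetric_array n0 \<mu>" "symmetric_array n0 \<nu>" "symmetric_array n0 \<omega>" and
    B: "B = contraction n0 (rescale n0 \<mu> U) (rescale n0 \<nu> V) (rescale n0 \<omega> W)" and
    delta: "contraction n0 U V W = hdelta n0"
    using assms(1) unfolding admits_spectral_decomposition_iff by blast
  obtain U' V' W' \<mu>' \<nu>' \<omega>' where
    sym': "symmetric_array n1 \<mu>'" "symmetric_array n1 \<nu>'" "symmetric_array n1 \<omega>'" and
    C: "C = contraction n1 (rescale n1 \<mu>' U') (rescale n1 \<nu>' V') (rescale n1 \<omega>' W')" and
    delta': "contraction n1 U' V' W' = hdelta n1"
    using assms(2) unfolding admits_spectral_decomposition_iff by blast
  let ?\<mu> = "array_direct_sum n0 \<mu> \<mu>'"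
  let ?\<nu> = "array_direct_sum n0 \<nu> \<nu>'"
  let ?\<omega> = "array_direct_sum n0 \<omega> \<omega>'"
  show ?thesis
    unfolding admits_spectral_decomposition_iff
  proof (intro bexI exI conjI)
    show "direct_sum n0 n1 B C = contraction (n0 + n1)
        (rescale (n0 + n1) ?\<mu> (direct_sum n0 n1 U U'))
        (rescale (n0 + n1) ?\<nu> (direct_sum n0 n1 V V'))
        (rescale (n0 + n1) ?\<omega> (direct_sum n0 n1 W W'))"
      by (simp add: B C contraction_direct_sum rescale_direct_sum)
    show "contraction (n0 + n1)
        (direct_sum n0 n1 U U') (direct_sum n0 n1 V V') (direct_sum n0 n1 W W') = hdelta (n0 + n1)"
      by (simp add: contraction_direct_sum delta delta' hdelta_direct_sum)
  qed (simp_all add: symmetric_array_direct_sum sym sym')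
qed


section \<open>Kronecker products\<close>

lemma sum_lessThan_mult_div_mod:
  fixes f :: "nat \<Rightarrow> nat \<Rightarrow> 'a::comm_monoid_add"
  shows "(\<Sum>t<a * b. f (t div b) (t mod b)) = (\<Sum>s<a. \<Sum>r<b. f s r)"
proof (induction a)
  case (Suc a)
  have "(\<Sum>t<Suc a * b. f (t div b) (t mod b))
      = (\<Sum>t<a * b. f (t div b) (t mod b)) + (\<Sum>r<b. f ((a * b + r) div b) ((a * b + r) mod b))"
    using sum_lessThan_add[of "\<lambda>t. f (t div b) (t mod b)" "a * b" b] by (simp add: add.commute)
  also have "(\<Sum>r<b. f ((a * b + r) div b) ((a * b + r) mod b)) = (\<Sum>r<b. f a r)"
    by (rule sum.cong) auto
  finally show ?case
    using Suc.IH by simp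
qed simp

lemma div_mod_less_of_less_mult:
  fixes i :: nat
  assumes "i < a * b"
  shows "i div b < a" "i mod b < b"
  using assms by (auto simp: less_mult_imp_div_less intro!: mod_less_divisor gr0I)

lemma symmetric_array_kronecker:
  assumes "symmetric_array n0 m" "symmetric_array n1 m'"
  shows "symmetric_array (n0 * n1) (array_kronecker n1 m m')"
  using assms by (simp add: symmetric_array_def array_kronecker_def div_mod_less_of_less_mult)

text \<open>Two indices agree exactly if their quotients and their remainders modulo \<open>n1\<close> agree.\<close>

lemma hdelta_kronecker: "kronecker n0 n1 (hdelta n0) (hdelta n1) = hdelta (n0 * n1)"
proof -
  have eq_iff: "i = j \<longleftrightarrow> i div n1 = j div n1 \<and> i mod n1 = j mod n1" for i j :: nat
    by (metis div_mult_mod_eq)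
  show ?thesis
    unfolding kronecker_def hdelta_def
  proof (rule mk_hypermat_cong)
    fix i j k assume "i < n0 * n1" "j < n0 * n1" "k < n0 * n1"
    then show "mk_hypermat n0 (\<lambda>i j k. if i = j \<and> j = k then 1 else 0)
          (i div n1) (j div n1) (k div n1) *
        mk_hypermat n1 (\<lambda>i j k. if i = j \<and> j = k then 1 else 0)
          (i mod n1) (j mod n1) (k mod n1) = (if i = j \<and> j = k then 1 else 0)"
      unfolding eq_iff[of i j] eq_iff[of j k]
      by (auto simp: mk_hypermat_def div_mod_less_of_less_mult)
  qed
qed

lemma rescale_kronecker:
  "rescale (n0 * n1) (array_kronecker n1 m m') (kronecker n0 n1 B C) =
   kronecker n0 n1 (rescale n0 m B) (rescale n1 m' C)"
  unfolding kronecker_def rescale_def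
  by (rule mk_hypermat_cong)
    (simp add: mk_hypermat_def array_kronecker_def div_mod_less_of_less_mult)

text \<open>
  Each term is a product of one depending only on the quotient of \<open>t\<close> and one depending only on
  its remainder, so the sum over \<open>t\<close> is a product of two sums.
\<close>

lemma contraction_kronecker:
  "contraction (n0 * n1) (kronecker n0 n1 U U') (kronecker n0 n1 V V') (kronecker n0 n1 W W') =
   kronecker n0 n1 (contraction n0 U V W) (contraction n1 U' V' W')"
  unfolding contraction_def kronecker_def
proof (rule mk_hypermat_cong)
  fix i j k assume less: "i < n0 * n1" "j < n0 * n1" "k < n0 * n1"
  define f where "f = (\<lambda>s. U (i div n1) s (k div n1) * V (j div n1) s (i div n1) *
    W (k div n1) s (j div n1))"
  define g where "g = (\<lambda>r. U' (i mod n1) r (k mod n1) * V' (j mod n1) r (i mod n1) *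
    W' (k mod n1) r (j mod n1))"
  let ?K = "\<lambda>B C. mk_hypermat (n0 * n1) (\<lambda>i j k.
     B (i div n1) (j div n1) (k div n1) * C (i mod n1) (j mod n1) (k mod n1))"
  have "(\<Sum>t<n0 * n1. ?K U U' i t k * ?K V V' j t i * ?K W W' k t j)
      = (\<Sum>t<n0 * n1. f (t div n1) * g (t mod n1))"
    using less by (intro sum.cong) (simp_all add: mk_hypermat_def f_def g_def)
  also have "\<dots> = (\<Sum>s<n0. \<Sum>r<n1. f s * g r)"
    by (rule sum_lessThan_mult_div_mod)
  also have "\<dots> = (\<Sum>s<n0. f s) * (\<Sum>r<n1. g r)"
    by (simp add: sum_product)
  also have "\<dots> =
      mk_hypermat n0 (\<lambda>i j k. \<Sum>t<n0. U i t k * V j t i * W k t j)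
        (i div n1) (j div n1) (k div n1) *
      mk_hypermat n1 (\<lambda>i j k. \<Sum>t<n1. U' i t k * V' j t i * W' k t j)
        (i mod n1) (j mod n1) (k mod n1)"
    using less by (simp add: mk_hypermat_def div_mod_less_of_less_mult f_def g_def)
  finally show "(\<Sum>t<n0 * n1. ?K U U' i t k * ?K V V' j t i * ?K W W' k t j) = \<dots>" .
qed

lemma admits_spectral_decomposition_kronecker:
  assumes "admits_spectral_decomposition n0 B" "admits_spectral_decomposition n1 C"
  shows "admits_spectral_decomposition (n0 * n1) (kronecker n0 n1 B C)"
proof -
  obtain U V W \<mu> \<nu> \<omega> where
    sym: "symmetric_array n0 \<mu>" "symmetric_array n0 \<nu>" "symmetric_array n0 \<omega>" and
    B: "B = contraction n0 (rescale n0 \<mu> U) (rescale n0 \<nu> V) (rescale n0 \<omega> W)" and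
    delta: "contraction n0 U V W = hdelta n0"
    using assms(1) unfolding admits_spectral_decomposition_iff by blast
  obtain U' V' W' \<mu>' \<nu>' \<omega>' where
    sym': "symmetric_array n1 \<mu>'" "symmetric_array n1 \<nu>'" "symmetric_array n1 \<omega>'" and
    C: "C = contraction n1 (rescale n1 \<mu>' U') (rescale n1 \<nu>' V') (rescale n1 \<omega>' W')" and
    delta': "contraction n1 U' V' W' = hdelta n1"
    using assms(2) unfolding admits_spectral_decomposition_iff by blast
  let ?\<mu> = "array_kronecker n1 \<mu> \<mu>'"
  let ?\<nu> = "array_kronecker n1 \<nu> \<nu>'"
  let ?\<omega> = "array_kronecker n1 \<omega> \<omega>'"
  show ?thesis
    unfolding admits_spectral_decomposition_iff
  proof (intro bexI exI conjI)
    show "kronecker n0 n1 B C = contraction (n0 * n1)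
        (rescale (n0 * n1) ?\<mu> (kronecker n0 n1 U U'))
        (rescale (n0 * n1) ?\<nu> (kronecker n0 n1 V V'))
        (rescale (n0 * n1) ?\<omega> (kronecker n0 n1 W W'))"
      by (simp add: B C contraction_kronecker rescale_kronecker)
    show "contraction (n0 * n1)
        (kronecker n0 n1 U U') (kronecker n0 n1 V V') (kronecker n0 n1 W W') = hdelta (n0 * n1)"
      by (simp add: contraction_kronecker delta delta' hdelta_kronecker)
  qed (simp_all add: symmetric_array_kronecker sym sym')
qed


section \<open>Generated hypermatrices\<close>

theorem theorem7:
  fixes n :: nat and A :: hypermat and G :: "hypermat set"
  assumes "A \<in> hypermats n"
    and "G \<subseteq> hypermats 2"
    and "generated G n A"
    and "\<forall>B \<in> G. admits_spectral_decomposition 2 B"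
  shows "admits_spectral_decomposition n A"
  using assms(3)
proof induction
  case (generator B)
  then show ?case
    using assms(4) by blast
next
  case (sum n0 B n1 C)
  from sum.IH show ?case
    by (rule admits_spectral_decomposition_direct_sum)
next
  case (kron n0 B n1 C)
  from kron.IH show ?case
    by (rule admits_spectral_decomposition_kronecker)
qed

end
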